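(* For every integer $d$ with $7\le d\le 15$ we have $N_{1/3}(d)=28$, and for every integer $d\ge 15$ we have $N_{1/3}(d)=2d-2$.
   Context: A set of (distinct) lines through the origin in $\mathbb{R}^d$ is called equiangular with common angle $\arccos(\alpha)$, $\alpha\in(0,1)$, if every two distinct lines of the set make the angle $\arccos(\alpha)$; equivalently, for unit vectors $v,w$ spanning two distinct lines of the set, $|\langle v,w\rangle|=\alpha$. For $\alpha\in(0,1)$, $N_\alpha(d)$ denotes the maximum number of equiangular lines in $\mathbb{R}^d$ with common angle $\arccos(\alpha)$. *)

theory Defs
  imports "HOL-Analysis.Analysis"
begin

definition line_through_origin :: "'a::euclidean_space set \<Rightarrow> bool" where
  "line_through_origin L \<longleftrightarrow> subspace L \<and> dim L = 1"

definition equiangular :: "real \<Rightarrow> 'a::euclidean_space set set \<Rightarrow> bool" where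
  "equiangular \<alpha> X \<longleftrightarrow>
     (\<forall>L\<in>X. line_through_origin L) \<and>
     (\<forall>L\<in>X. \<forall>M\<in>X. L \<noteq> M \<longrightarrow>
        (\<forall>v\<in>L. \<forall>w\<in>M. norm v = 1 \<longrightarrow> norm w = 1 \<longrightarrow> \<bar>v \<bullet> w\<bar> = \<alpha>))"

(* The ambient space is passed as a type argument: N \<alpha> TYPE(real ^ 'n) is the number
   N_\<alpha>(d) for d = CARD('n).  Restricting to finite X and using Max loses nothing, since by
   equiangular_bounded below there are no infinite equiangular sets when \<alpha> < 1 and the set
   of cardinalities is finite; it contains 0, so Max is a genuine maximum. *)
definition N :: "real \<Rightarrow> 'a::euclidean_space itself \<Rightarrow> nat" where
  "N \<alpha> (_ :: 'a itself) = Max {card X | X :: 'a set set. finite X \<and> equiangular \<alpha> X}"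

lemma equiangular_bounded:
  assumes "\<alpha> < 1"
  shows "\<exists>k. \<forall>X :: 'a::euclidean_space set set. equiangular \<alpha> X \<longrightarrow> finite X \<and> card X \<le> k"
proof -
  define r where "r = sqrt ((1 - \<alpha>) / 2)"
  have r: "r > 0" "4 * r\<^sup>2 = 2 - 2 * \<alpha>"
    using assms by (auto simp: r_def field_simps)
  obtain K :: "'a set" where K: "finite K" "sphere 0 1 \<subseteq> (\<Union>c\<in>K. ball c r)"
  proof (rule compactE_image[OF compact_sphere[of "0::'a" 1], of "sphere 0 1" "\<lambda>c. ball c r"])
    show "sphere (0::'a) 1 \<subseteq> (\<Union>c\<in>sphere 0 1. ball c r)"
      using r(1) by (metis UN_I centre_in_ball subsetI)
  qed auto
  have "finite X \<and> card X \<le> card K" if X: "equiangular \<alpha> X" for X :: "'a set set"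
  proof -
    have "\<exists>c\<in>K. \<exists>v\<in>L. norm v = 1 \<and> dist c v < r" if "L \<in> X" for L
    proof -
      from X that have L: "subspace L" "dim L = 1"
        by (auto simp: equiangular_def line_through_origin_def)
      then have "\<not> L \<subseteq> {0}"
        using dim_eq_0[of L] by auto
      then obtain u where u: "u \<in> L" "u \<noteq> 0" by auto
      then have v: "sgn u \<in> L" "norm (sgn u) = 1"
        using L(1) by (auto simp: sgn_div_norm norm_sgn subspace_scale)
      then have "sgn u \<in> (\<Union>c\<in>K. ball c r)" using K(2) by (metis mem_sphere_0 subsetD)
      then obtain c where "c \<in> K" "dist c (sgn u) < r" by auto
      with v show ?thesis by blast
    qed
    then obtain c f where cf: "\<And>L. L \<in> X \<Longrightarrow> c L \<in> K \<and> f L \<in> L \<and> norm (f L) = 1 \<and> dist (c L) (f L) < r"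
      by metis
    have "inj_on c X"
    proof (rule inj_onI, rule ccontr)
      fix L M assume LM: "L \<in> X" "M \<in> X" "c L = c M" "L \<noteq> M"
      have "\<bar>f L \<bullet> f M\<bar> = \<alpha>"
        using X LM cf[OF LM(1)] cf[OF LM(2)] by (auto simp: equiangular_def)
      moreover have "(dist (f L) (f M))\<^sup>2 = 2 - 2 * (f L \<bullet> f M)"
        using cf[OF LM(1)] cf[OF LM(2)]
        by (simp add: dist_norm power2_norm_eq_inner algebra_simps inner_commute norm_eq_1)
      ultimately have "(2 * r)\<^sup>2 \<le> (dist (f L) (f M))\<^sup>2"
        using r(2) by (simp add: power_mult_distrib)
      then have "2 * r \<le> dist (f L) (f M)"
        by (rule power2_le_imp_le) simp
      moreover have "dist (f L) (f M) < 2 * r"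
        using cf[OF LM(1)] cf[OF LM(2)] LM(3) dist_triangle2[of "f L" "f M" "c M"]
        by (simp add: dist_commute)
      ultimately show False by simp
    qed
    moreover have "c ` X \<subseteq> K" using cf by auto
    ultimately show ?thesis
      using K(1) by (auto intro: inj_on_finite card_inj_on_le)
  qed
  then show ?thesis by blast
qed

end

theory Submission
  imports Defs
begin

text \<open>
  Both configurations that attain the maximum are explicit. For \<open>2d - 2\<close> lines, fix one basis
  vector \<open>e\<^sub>0\<close> of the space and take \<open>e\<^sub>0 \<plusminus> sqrt 2 e\<^sub>j\<close> for the remaining \<open>d - 1\<close> basis vectors \<open>e\<^sub>j\<close>:
  these have squared length 3 and mutual inner products 1 or -1. For 28 lines, put signs on the
  three coordinates of each line of the Fano plane; a pair of opposite sign patterns gives one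
  line, so every Fano line contributes four. Supports of different Fano lines share one
  coordinate, so again all squared lengths are 3 and all inner products are 1 or -1.

  For the upper bound \<open>max 28 (2d - 2)\<close>, choose a unit vector \<open>q\<close> on one of the lines and unit
  vectors on the others, each with inner product 1/3 with \<open>q\<close>. If all mutual inner products are 1/3, the
  vectors are linearly independent and there are at most \<open>d\<close> of them. Otherwise some \<open>x\<close>, \<open>y\<close>
  have inner product -1/3, and \<open>z = q - x - y\<close> turns out to be a unit vector with inner product
  -1/3 with both. So \<open>q = x + y + z\<close> is the sum of three vectors that look alike,
  and the inner products of any further vector \<open>u\<close> with \<open>x\<close>, \<open>y\<close>, \<open>z\<close> are 1/3 or -1/3 and sum to 1/3,
  which means that exactly one of them is -1/3. This sorts the further vectors into three
  \<^emph>\<open>pillars\<close>. All vectors of one pillar have the same projection \<open>h\<close> onto the span of \<open>x\<close>, \<open>y\<close>, \<open>z\<close>,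
  with squared length 1/3; the three projections are mutually orthogonal.

  After subtraction of \<open>h\<close>, two vectors of one pillar are orthogonal or opposite
  (\<open>pillar_half\<close>), so at least half of a pillar is an orthogonal family in the
  \<open>d - 3\<close> dimensions that remain. If only one pillar is occupied, this gives
  \<open>4 + 2 (d - 3) = 2d - 2\<close> lines (\<open>pillar_card_le_dim\<close>). If a second pillar
  contains a vector, its residual has inner product 1/3 or -1/3 with each member of that orthogonal
  family, all of squared length 2/3, and Bessel's inequality allows the family only four
  members (\<open>pillar_card_le_8\<close>); then there are at most \<open>4 + 3 * 8 = 28\<close> lines.
\<close>

section \<open>Lines and unit vectors\<close>

definition equiangular_vectors :: "real \<Rightarrow> 'a::euclidean_space set \<Rightarrow> bool" where
  "equiangular_vectors \<alpha> V \<longleftrightarrow>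
     (\<forall>v\<in>V. v \<bullet> v = 1) \<and> (\<forall>v\<in>V. \<forall>w\<in>V. v \<noteq> w \<longrightarrow> \<bar>v \<bullet> w\<bar> = \<alpha>)"

lemma equiangular_vectorsD:
  assumes "equiangular_vectors \<alpha> V" "v \<in> V" "w \<in> V" "v \<noteq> w"
  shows "v \<bullet> w = \<alpha> \<or> v \<bullet> w = - \<alpha>"
  using assms unfolding equiangular_vectors_def by (metis abs_if minus_minus)

lemma unit_vectors_eqI:
  fixes v w :: "'a::real_inner"
  assumes "v \<bullet> v = 1" "w \<bullet> w = 1" "v \<bullet> w = 1"
  shows "v = w"
proof -
  have "(v - w) \<bullet> (v - w) = 0"
    using assms by (simp add: inner_diff_left inner_diff_right inner_commute)
  then show ?thesis by simp
qed

lemma line_has_unit_vector: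
  assumes "line_through_origin L"
  shows "\<exists>v\<in>L. norm v = 1"
proof -
  from assms have L: "subspace L" "dim L = 1"
    by (auto simp: line_through_origin_def)
  then have "\<not> L \<subseteq> {0}"
    using dim_eq_0[of L] by auto
  then obtain u where "u \<in> L" "u \<noteq> 0" by auto
  then have "sgn u \<in> L" "norm (sgn u) = 1"
    using L(1) by (auto simp: sgn_div_norm norm_sgn subspace_scale)
  then show ?thesis by blast
qed

lemma equiangular_vectors_of_lines:
  fixes X :: "'a::euclidean_space set set"
  assumes X: "equiangular \<alpha> X" and fin: "finite X" and \<alpha>: "\<alpha> \<noteq> 1"
  obtains V :: "'a set" where "finite V" "equiangular_vectors \<alpha> V" "card V = card X"
proof -
  have lines: "\<And>L. L \<in> X \<Longrightarrow> line_through_origin L"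
    and angle: "\<And>L M v w. \<lbrakk>L \<in> X; M \<in> X; L \<noteq> M; v \<in> L; w \<in> M; norm v = 1; norm w = 1\<rbrakk>
      \<Longrightarrow> \<bar>v \<bullet> w\<bar> = \<alpha>"
    using X by (auto simp: equiangular_def)
  define f where "f L = (SOME v. v \<in> L \<and> norm v = 1)" for L :: "'a set"
  have f: "f L \<in> L \<and> norm (f L) = 1" if "L \<in> X" for L
    unfolding f_def by (rule someI_ex) (use line_has_unit_vector[OF lines[OF that]] in blast)
  have ip: "\<bar>f L \<bullet> f M\<bar> = \<alpha>" if "L \<in> X" "M \<in> X" "L \<noteq> M" for L M
    using angle[OF that] f that by simp
  have inj: "inj_on f X"
  proof (rule inj_onI, rule ccontr)
    fix L M assume LM: "L \<in> X" "M \<in> X" "f L = f M" "L \<noteq> M"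
    then have "f L \<bullet> f M = 1"
      using f[of M] by (simp add: norm_eq_1)
    then show False
      using ip[OF LM(1,2,4)] \<alpha> by simp
  qed
  show ?thesis
  proof (rule that[of "f ` X"])
    show "finite (f ` X)" using fin by simp
    have unit: "f L \<bullet> f L = 1" if "L \<in> X" for L
      using f[OF that] by (simp add: norm_eq_1)
    have "\<bar>f L \<bullet> f M\<bar> = \<alpha>" if "L \<in> X" "M \<in> X" "f L \<noteq> f M" for L M
      using ip[OF that(1,2)] that(3) by metis
    with unit show "equiangular_vectors \<alpha> (f ` X)"
      unfolding equiangular_vectors_def by blast
    show "card (f ` X) = card X" by (rule card_image[OF inj])
  qed
qed

text \<open>The explicit configurations are given by vectors of a common length other than 1; rescaling to
  unit length is done here once for both.\<close>

lemma equiangular_spans: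
  fixes v :: "'i \<Rightarrow> 'a::euclidean_space"
  assumes fin: "finite I" and r: "r > 0" and \<alpha>: "\<alpha> < 1"
    and diag: "\<And>i. i \<in> I \<Longrightarrow> v i \<bullet> v i = r"
    and off: "\<And>i j. i \<in> I \<Longrightarrow> j \<in> I \<Longrightarrow> i \<noteq> j \<Longrightarrow> \<bar>v i \<bullet> v j\<bar> = \<alpha> * r"
  shows "\<exists>X :: 'a set set. finite X \<and> equiangular \<alpha> X \<and> card X = card I"
proof -
  have unit: "\<bar>a\<bar> * sqrt r = 1" if "i \<in> I" "norm (a *\<^sub>R v i) = 1" for i a
  proof -
    have "norm (v i) = sqrt r" using diag[OF that(1)] by (simp add: norm_eq_sqrt_inner)
    then show ?thesis using that(2) by simp
  qed
  have angle: "\<bar>x \<bullet> y\<bar> = \<alpha>"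
    if "i \<in> I" "j \<in> I" "i \<noteq> j" "x \<in> span {v i}" "y \<in> span {v j}" "norm x = 1" "norm y = 1"
    for i j x y
  proof -
    obtain a b where ab: "x = a *\<^sub>R v i" "y = b *\<^sub>R v j"
      using \<open>x \<in> span {v i}\<close> \<open>y \<in> span {v j}\<close> by (auto simp: span_singleton)
    have "(\<bar>a\<bar> * sqrt r) * (\<bar>b\<bar> * sqrt r) = 1"
      using unit[of i a] unit[of j b] \<open>i \<in> I\<close> \<open>j \<in> I\<close> \<open>norm x = 1\<close> \<open>norm y = 1\<close> ab by simp
    moreover have "(\<bar>a\<bar> * sqrt r) * (\<bar>b\<bar> * sqrt r) = \<bar>a\<bar> * \<bar>b\<bar> * (sqrt r * sqrt r)"
      by (simp only: mult_ac)
    ultimately have 1: "\<bar>a\<bar> * \<bar>b\<bar> * r = 1"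
      using r by simp
    have "\<bar>x \<bullet> y\<bar> = \<bar>a\<bar> * (\<bar>b\<bar> * (\<alpha> * r))"
      using off[OF \<open>i \<in> I\<close> \<open>j \<in> I\<close> \<open>i \<noteq> j\<close>] ab by (simp add: abs_mult)
    also have "\<dots> = \<alpha> * (\<bar>a\<bar> * \<bar>b\<bar> * r)"
      by (simp only: mult_ac)
    finally show ?thesis
      using 1 by simp
  qed
  have line: "line_through_origin (span {v i})" if "i \<in> I" for i
  proof -
    have "v i \<noteq> 0" using diag[OF that] r by auto
    then show ?thesis by (simp add: line_through_origin_def dim_span dim_singleton)
  qed
  have inj: "inj_on (\<lambda>i. span {v i}) I"
  proof (rule inj_onI, rule ccontr)
    fix i j assume ij: "i \<in> I" "j \<in> I" "span {v i} = span {v j}" "i \<noteq> j"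
    obtain x where x: "x \<in> span {v i}" "norm x = 1"
      using line_has_unit_vector[OF line[OF ij(1)]] by blast
    have "\<bar>x \<bullet> x\<bar> = \<alpha>"
      by (rule angle[OF ij(1,2,4)]) (use x ij(3) in auto)
    then show False using x(2) \<alpha> by (simp add: norm_eq_1)
  qed
  have "equiangular \<alpha> ((\<lambda>i. span {v i}) ` I)"
    unfolding equiangular_def
  proof (intro conjI ballI impI)
    show "line_through_origin L" if "L \<in> (\<lambda>i. span {v i}) ` I" for L
      using that line by auto
    fix L M x y
    assume "L \<in> (\<lambda>i. span {v i}) ` I" "M \<in> (\<lambda>i. span {v i}) ` I" "L \<noteq> M"
      "x \<in> L" "y \<in> M" "norm x = 1" "norm y = 1"
    then show "\<bar>x \<bullet> y\<bar> = \<alpha>"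
      using angle by blast
  qed
  moreover have "finite ((\<lambda>i. span {v i}) ` I)" using fin by simp
  moreover have "card ((\<lambda>i. span {v i}) ` I) = card I" by (rule card_image[OF inj])
  ultimately show ?thesis by (intro exI conjI)
qed

text \<open>Each line offers a choice between two opposite unit vectors; here it is made so that every vector
  is on the same side as \<open>q\<close>.\<close>

lemma equiangular_vectors_flip:
  assumes V: "equiangular_vectors \<alpha> V" and \<alpha>: "0 < \<alpha>" "\<alpha> < 1" and q: "q \<in> V" and fin: "finite V"
  obtains W where "finite W" "equiangular_vectors \<alpha> W" "card W = card V" "q \<in> W"
    "\<And>u. u \<in> W \<Longrightarrow> u \<noteq> q \<Longrightarrow> u \<bullet> q = \<alpha>"
proof -
  define \<sigma> :: "'a \<Rightarrow> real" where "\<sigma> u = (if u \<bullet> q < 0 then -1 else 1)" for u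
  define f where "f u = \<sigma> u *\<^sub>R u" for u
  have sq: "\<sigma> u * \<sigma> u = 1" "\<bar>\<sigma> u\<bar> = 1" for u by (auto simp: \<sigma>_def)
  have unit: "u \<bullet> u = 1" if "u \<in> V" for u
    using V that by (simp add: equiangular_vectors_def)
  have unit': "f u \<bullet> f u = 1" if "u \<in> V" for u
    using unit[OF that] sq by (simp add: f_def)
  have off: "\<bar>f u \<bullet> f w\<bar> = \<alpha>" if "u \<in> V" "w \<in> V" "u \<noteq> w" for u w
    using V that sq by (simp add: f_def abs_mult equiangular_vectors_def)
  have fq: "f q = q" using unit[OF q] by (simp add: f_def \<sigma>_def)
  have inj: "inj_on f V"
  proof (rule inj_onI, rule ccontr)
    fix u w assume uw: "u \<in> V" "w \<in> V" "f u = f w" "u \<noteq> w"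
    then show False using off[OF uw(1,2,4)] unit'[OF uw(1)] \<alpha> by simp
  qed
  show ?thesis
  proof
    show "finite (f ` V)" using fin by simp
    show "equiangular_vectors \<alpha> (f ` V)"
      using unit' off by (auto simp: equiangular_vectors_def)
    show "card (f ` V) = card V" by (rule card_image[OF inj])
    show "q \<in> f ` V" using q fq by (metis imageI)
    fix u assume "u \<in> f ` V" "u \<noteq> q"
    then obtain w where w: "w \<in> V" "u = f w" "w \<noteq> q" using fq by auto
    have "\<bar>w \<bullet> q\<bar> = \<alpha>" using V w q by (simp add: equiangular_vectors_def)
    then show "u \<bullet> q = \<alpha>" using w(2) by (auto simp: f_def \<sigma>_def)
  qed
qed

section \<open>Pillars\<close>

lemma orthogonal_family_card_le:
  fixes f :: "'i \<Rightarrow> 'a::euclidean_space"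
  assumes nz: "\<And>i. i \<in> I \<Longrightarrow> f i \<noteq> 0"
    and orth: "\<And>i j. i \<in> I \<Longrightarrow> j \<in> I \<Longrightarrow> i \<noteq> j \<Longrightarrow> f i \<bullet> f j = 0"
  shows "card I \<le> DIM('a)"
proof -
  have inj: "inj_on f I"
    by (rule inj_onI) (metis inner_eq_zero_iff nz orth)
  have "pairwise orthogonal (f ` I)"
    using orth by (auto simp: pairwise_def orthogonal_def)
  moreover have "0 \<notin> f ` I" using nz by auto
  ultimately have "independent (f ` I)"
    by (rule pairwise_orthogonal_independent)
  then have "card (f ` I) \<le> DIM('a)"
    using independent_bound by blast
  then show ?thesis using card_image[OF inj] by simp
qed

text \<open>This is Bessel's inequality for an orthogonal family of vectors of equal length, in the case that
  \<open>s\<close> has the same inner product up to sign with all of them. It comes from the nonnegative squared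
  length of \<open>c s - p\<close>, where \<open>p / c\<close> is the projection of \<open>s\<close> onto the span of the family.\<close>

lemma bessel_uniform:
  fixes f :: "'i \<Rightarrow> 'a::real_inner"
  assumes fin: "finite I" and c: "c > 0"
    and diag: "\<And>i. i \<in> I \<Longrightarrow> f i \<bullet> f i = c"
    and orth: "\<And>i j. i \<in> I \<Longrightarrow> j \<in> I \<Longrightarrow> i \<noteq> j \<Longrightarrow> f i \<bullet> f j = 0"
    and b: "\<And>i. i \<in> I \<Longrightarrow> \<bar>s \<bullet> f i\<bar> = b"
  shows "real (card I) * b\<^sup>2 \<le> c * (s \<bullet> s)"
proof -
  define p where "p = (\<Sum>i\<in>I. (s \<bullet> f i) *\<^sub>R f i)"
  have b2: "(s \<bullet> f i) * (s \<bullet> f i) = b\<^sup>2" if "i \<in> I" for i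
    using b[OF that] by (metis power2_abs power2_eq_square)
  have sp: "s \<bullet> p = real (card I) * b\<^sup>2"
    unfolding p_def by (simp add: inner_sum_right b2)
  have fp: "f i \<bullet> p = c * (s \<bullet> f i)" if "i \<in> I" for i
  proof -
    have "f i \<bullet> p = (\<Sum>j\<in>I. if j = i then c * (s \<bullet> f i) else 0)"
      unfolding p_def inner_sum_right
      by (rule sum.cong) (use that orth diag in auto)
    then show ?thesis using fin that by simp
  qed
  have "p \<bullet> p = (\<Sum>i\<in>I. (s \<bullet> f i) * (f i \<bullet> p))"
    by (subst (1) p_def) (simp add: inner_sum_left)
  also have "\<dots> = (\<Sum>i\<in>I. c * b\<^sup>2)"
    by (rule sum.cong) (auto simp: fp b2[symmetric])
  finally have pp: "p \<bullet> p = c * (real (card I) * b\<^sup>2)" by simp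
  have "0 \<le> (c *\<^sub>R s - p) \<bullet> (c *\<^sub>R s - p)" by simp
  also have "\<dots> = c * (c * (s \<bullet> s) - real (card I) * b\<^sup>2)"
    by (simp add: inner_diff_left inner_diff_right inner_commute[of p s] sp pp algebra_simps)
  finally show ?thesis using c by (simp add: zero_le_mult_iff)
qed

text \<open>The vector \<open>h\<close> is the common projection of the members of \<open>C\<close> onto the space spanned by the three
  base vectors. The last two conditions say that \<open>h\<close> is orthogonal to every residual \<open>u - h\<close>, which
  then has squared length 2/3.\<close>

definition pillar :: "'a::euclidean_space \<Rightarrow> 'a set \<Rightarrow> bool" where
  "pillar h C \<longleftrightarrow> equiangular_vectors (1/3) C \<and> h \<bullet> h = 1/3 \<and> (\<forall>u\<in>C. u \<bullet> h = 1/3)"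

lemma pillar_residual_inner:
  assumes "pillar h C" "u \<in> C" "w \<in> C"
  shows "(u - h) \<bullet> (w - h) = u \<bullet> w - 1/3"
proof -
  have "h \<bullet> h = 1/3" "u \<bullet> h = 1/3" "h \<bullet> w = 1/3"
    using assms by (auto simp: pillar_def inner_commute)
  then show ?thesis by (simp add: inner_diff_left inner_diff_right)
qed

text \<open>By the preceding lemma the residuals of two members have inner product 0 or -2/3. In the second case
  they are opposite, since their squared length is 2/3. So if \<open>A\<close> is maximal with pairwise
  orthogonal residuals, every member outside \<open>A\<close> is the reflection \<open>2 h - u\<close> of some \<open>u\<close> in \<open>A\<close>.\<close>

lemma pillar_half:
  assumes C: "pillar h C" and fin: "finite C"
  obtains A where "A \<subseteq> C" "card C \<le> 2 * card A"
    "\<And>u w. u \<in> A \<Longrightarrow> w \<in> A \<Longrightarrow> u \<noteq> w \<Longrightarrow> u \<bullet> w = 1/3"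
proof -
  define good where "good A \<longleftrightarrow> A \<subseteq> C \<and> (\<forall>u\<in>A. \<forall>w\<in>A. u \<noteq> w \<longrightarrow> u \<bullet> w = 1/3)" for A
  have "finite {A. good A}" "{} \<in> {A. good A}"
    using fin by (auto simp: good_def intro: finite_subset[of _ "Pow C"])
  then obtain A where A: "good A" and max: "\<And>B. good B \<Longrightarrow> A \<subseteq> B \<Longrightarrow> A = B"
    using finite_has_maximal2[of "{A. good A}" "{}"] by auto
  have finA: "finite A" using A fin finite_subset by (auto simp: good_def)
  have "C \<subseteq> A \<union> (\<lambda>u. 2 *\<^sub>R h - u) ` A"
  proof
    fix w assume w: "w \<in> C"
    show "w \<in> A \<union> (\<lambda>u. 2 *\<^sub>R h - u) ` A"
    proof (cases "w \<in> A")
      case False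
      then have "\<not> good (insert w A)" using max by auto
      then obtain u where u: "u \<in> A" "u \<bullet> w \<noteq> 1/3"
        using A w by (auto simp: good_def inner_commute)
      then have uC: "u \<in> C" using A by (auto simp: good_def)
      have "u \<noteq> w" using False u by auto
      then have uw: "u \<bullet> w = - (1/3)"
        using C u w uC equiangular_vectorsD unfolding pillar_def by blast
      have "u \<bullet> u = 1" "w \<bullet> w = 1" "u \<bullet> h = 1/3" "w \<bullet> h = 1/3" "h \<bullet> h = 1/3"
        using C uC w by (auto simp: pillar_def equiangular_vectors_def)
      then have "(w - (2 *\<^sub>R h - u)) \<bullet> (w - (2 *\<^sub>R h - u)) = 0"
        using uw by (simp add: inner_diff_left inner_diff_right inner_commute)
      then have "w = 2 *\<^sub>R h - u" by simp
      then show ?thesis using u by auto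
    qed simp
  qed
  then have "card C \<le> card (A \<union> (\<lambda>u. 2 *\<^sub>R h - u) ` A)"
    using finA by (intro card_mono) auto
  also have "\<dots> \<le> card A + card ((\<lambda>u. 2 *\<^sub>R h - u) ` A)" by (rule card_Un_le)
  also have "\<dots> \<le> 2 * card A" using card_image_le[OF finA] by simp
  finally show ?thesis using that A by (auto simp: good_def)
qed

text \<open>The residual \<open>t - k\<close> of a vector in another pillar meets the orthogonal residuals of
  \<open>C\<close> all at the same angle up to sign, and Bessel's inequality limits their number to
  \<open>(2/3)\<^sup>2 / (1/3)\<^sup>2 = 4\<close>.\<close>

lemma pillar_card_le_8:
  assumes C: "pillar h C" and fin: "finite C"
    and D: "pillar k D" and t: "t \<in> D" and hk: "h \<bullet> k = 0" and th: "t \<bullet> h = 0"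
    and Ck: "\<And>u. u \<in> C \<Longrightarrow> u \<bullet> k = 0" and Ct: "\<And>u. u \<in> C \<Longrightarrow> \<bar>u \<bullet> t\<bar> = 1/3"
  shows "card C \<le> 8"
proof -
  obtain A where A: "A \<subseteq> C" "card C \<le> 2 * card A"
    "\<And>u w. u \<in> A \<Longrightarrow> w \<in> A \<Longrightarrow> u \<noteq> w \<Longrightarrow> u \<bullet> w = 1/3"
    using pillar_half[OF C fin] by blast
  have unit: "u \<bullet> u = 1" if "u \<in> A" for u
    using C A(1) that by (auto simp: pillar_def equiangular_vectors_def)
  have tt: "(t - k) \<bullet> (t - k) = 2/3"
    using pillar_residual_inner[OF D t t] D t by (simp add: pillar_def equiangular_vectors_def)
  have "real (card A) * (1/3)\<^sup>2 \<le> 2/3 * ((t - k) \<bullet> (t - k))"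
  proof (rule bessel_uniform)
    show "finite A" using A(1) fin finite_subset by blast
    show "(u - h) \<bullet> (u - h) = 2/3" if "u \<in> A" for u
      using pillar_residual_inner[OF C, of u u] A(1) that unit by auto
    show "(u - h) \<bullet> (w - h) = 0" if "u \<in> A" "w \<in> A" "u \<noteq> w" for u w
      using pillar_residual_inner[OF C, of u w] A(1) A(3)[OF that] that by auto
    show "\<bar>(t - k) \<bullet> (u - h)\<bar> = 1/3" if "u \<in> A" for u
    proof -
      have "(t - k) \<bullet> (u - h) = u \<bullet> t"
        using Ck[of u] A(1) that hk th
        by (auto simp: inner_diff_left inner_diff_right inner_commute)
      then show ?thesis using Ct A(1) that by auto
    qed
  qed simp
  then have "card A \<le> 4" using tt by (simp add: power2_eq_square)
  then show ?thesis using A(2) by simp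
qed

text \<open>The orthogonal residuals and \<open>H\<close> together form an orthogonal family, so their total number is at
  most the dimension. In the application, \<open>H\<close> consists of the projections of all three
  pillars.\<close>

lemma pillar_card_le_dim:
  fixes h :: "'a::euclidean_space"
  assumes C: "pillar h C" and fin: "finite C" and H: "finite H" "0 \<notin> H" "pairwise orthogonal H"
    and hH: "\<And>k. k \<in> H \<Longrightarrow> k = h \<or> k \<bullet> h = 0 \<and> (\<forall>u\<in>C. u \<bullet> k = 0)"
  shows "card C + 2 * card H \<le> 2 * DIM('a)"
proof -
  obtain A where A: "A \<subseteq> C" "card C \<le> 2 * card A"
    "\<And>u w. u \<in> A \<Longrightarrow> w \<in> A \<Longrightarrow> u \<noteq> w \<Longrightarrow> u \<bullet> w = 1/3"
    using pillar_half[OF C fin] by blast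
  have finA: "finite A" using A(1) fin finite_subset by blast
  have uu: "(u - h) \<bullet> (u - h) = 2/3" if "u \<in> A" for u
    using pillar_residual_inner[OF C, of u u] C A(1) that
    by (auto simp: pillar_def equiangular_vectors_def)
  have uw: "(u - h) \<bullet> (w - h) = 0" if "u \<in> A" "w \<in> A" "u \<noteq> w" for u w
    using pillar_residual_inner[OF C, of u w] A(1) A(3)[OF that] that by auto
  have uk: "(u - h) \<bullet> k = 0" if "u \<in> A" "k \<in> H" for u k
  proof -
    have "u \<bullet> h = 1/3" "h \<bullet> h = 1/3" "u \<in> C"
      using C A(1) that(1) by (auto simp: pillar_def)
    then show ?thesis
      using hH[OF that(2)] inner_commute[of h k] by (auto simp: inner_diff_left)
  qed
  have ku: "k \<bullet> (u - h) = 0" if "u \<in> A" "k \<in> H" for u k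
    using uk[OF that] by (simp add: inner_commute)
  \<comment> \<open>The disjoint sum makes the residuals and \<open>H\<close> a single family without comparing their members.\<close>
  have "card (A <+> H) \<le> DIM('a)"
  proof (rule orthogonal_family_card_le[where f = "case_sum (\<lambda>u. u - h) (\<lambda>k. k)"])
    show "case_sum (\<lambda>u. u - h) (\<lambda>k. k) i \<noteq> 0" if "i \<in> A <+> H" for i
      using that uu H(2) by fastforce
    show "case_sum (\<lambda>u. u - h) (\<lambda>k. k) i \<bullet> case_sum (\<lambda>u. u - h) (\<lambda>k. k) j = 0"
      if "i \<in> A <+> H" "j \<in> A <+> H" "i \<noteq> j" for i j
      using that uw uk ku H(3)
      by (cases i; cases j) (simp_all add: Plus_def image_iff pairwise_def orthogonal_def)
  qed
  then show ?thesis using A(2) finA H(1) by (simp add: card_Plus)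
qed

section \<open>The upper bound\<close>

text \<open>The Gram matrix is \<open>(1 - \<alpha>) I + \<alpha> J\<close> with \<open>J\<close> the all-ones matrix. Applied to a linear
  relation, its rows force all coefficients to be the same multiple of their sum \<open>S\<close>, and adding up the
  rows forces \<open>S = 0\<close>.\<close>

lemma equal_inner_card_le_dim:
  fixes V :: "'a::euclidean_space set"
  assumes fin: "finite V" and \<alpha>: "0 \<le> \<alpha>" "\<alpha> < 1" and diag: "\<And>v. v \<in> V \<Longrightarrow> v \<bullet> v = 1"
    and off: "\<And>v w. v \<in> V \<Longrightarrow> w \<in> V \<Longrightarrow> v \<noteq> w \<Longrightarrow> v \<bullet> w = \<alpha>"
  shows "card V \<le> DIM('a)"
proof -
  have "independent V"
  proof (rule independent_if_scalars_zero[OF fin])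
    fix c x assume 0: "(\<Sum>v\<in>V. c v *\<^sub>R v) = 0" and x: "x \<in> V"
    define S where "S = (\<Sum>v\<in>V. c v)"
    have row: "(1 - \<alpha>) * c w = - \<alpha> * S" if w: "w \<in> V" for w
    proof -
      have "0 = (\<Sum>v\<in>V. c v *\<^sub>R v) \<bullet> w" using 0 by simp
      also have "\<dots> = (\<Sum>v\<in>V. \<alpha> * c v + (if v = w then (1 - \<alpha>) * c w else 0))"
        unfolding inner_sum_left
        by (rule sum.cong) (use w diag off in \<open>auto simp: algebra_simps\<close>)
      also have "\<dots> = \<alpha> * S + (1 - \<alpha>) * c w"
        using fin w by (simp add: sum.distrib S_def sum_distrib_left)
      finally show ?thesis by simp
    qed
    have "(1 - \<alpha>) * S = (\<Sum>w\<in>V. (1 - \<alpha>) * c w)"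
      by (simp add: S_def sum_distrib_left)
    also have "\<dots> = - (real (card V) * \<alpha> * S)" using row by simp
    finally have "(1 - \<alpha> + real (card V) * \<alpha>) * S = 0" by (simp add: algebra_simps)
    moreover have "1 - \<alpha> + real (card V) * \<alpha> > 0"
      using \<alpha> by (intro add_pos_nonneg) auto
    ultimately have "S = 0" by simp
    then show "c x = 0" using row[OF x] \<alpha> by simp
  qed
  then show ?thesis using independent_bound by blast
qed

text \<open>The members of \<open>W\<close> are sorted by which of \<open>x\<close>, \<open>y\<close>, \<open>z\<close> gives the inner product -1/3. Either one
  pillar is all of \<open>W\<close>, and the dimension bounds it, or every pillar sees a vector of another one and
  has at most 8 members.\<close>

lemma card_le_three_pillars:
  fixes x y z :: "'a::euclidean_space"
  assumes fin: "finite W" and W: "equiangular_vectors (1/3) W"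
    and unit: "x \<bullet> x = 1" "y \<bullet> y = 1" "z \<bullet> z = 1"
    and off: "x \<bullet> y = -1/3" "x \<bullet> z = -1/3" "y \<bullet> z = -1/3"
    and cases: "\<And>u. u \<in> W \<Longrightarrow> u \<bullet> x = -1/3 \<and> u \<bullet> y = 1/3 \<and> u \<bullet> z = 1/3 \<or>
      u \<bullet> x = 1/3 \<and> u \<bullet> y = -1/3 \<and> u \<bullet> z = 1/3 \<or> u \<bullet> x = 1/3 \<and> u \<bullet> y = 1/3 \<and> u \<bullet> z = -1/3"
  shows "card W \<le> 24 \<or> card W + 6 \<le> 2 * DIM('a)"
proof -
  \<comment> \<open>Numbering the base vectors lets the three pillars share one argument; \<open>h i\<close> is half the sum
    of the two base vectors other than \<open>e i\<close>.\<close>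
  define e where "e i = (if i = 0 then x else if i = 1 then y else z)" for i :: nat
  define h where "h i = (1/2) *\<^sub>R (x + y + z - e i)" for i
  define C where "C i = {u\<in>W. u \<bullet> e i = -1/3}" for i
  have less3: "i < 3 \<longleftrightarrow> i = 0 \<or> i = 1 \<or> i = 2" for i :: nat by auto
  have offs: "x \<bullet> y = -1/3" "x \<bullet> z = -1/3" "y \<bullet> z = -1/3"
    "y \<bullet> x = -1/3" "z \<bullet> x = -1/3" "z \<bullet> y = -1/3"
    using off by (auto simp: inner_commute)
  have Wh: "u \<bullet> h i = (if u \<in> C i then 1/3 else 0)" if "u \<in> W" "i < 3" for u i
    using cases[OF that(1)] that
    by (auto simp: less3 h_def e_def C_def inner_add_right inner_diff_right)
  have hh: "h i \<bullet> h j = (if i = j then 1/3 else 0)" if "i < 3" "j < 3" for i j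
    using that unit offs
    by (auto simp: less3 h_def e_def inner_add_right inner_diff_right inner_add_left inner_diff_left)
  have union: "W = C 0 \<union> C 1 \<union> C 2"
    using cases by (auto simp: C_def e_def)
  have disj: "C i \<inter> C j = {}" if "i < 3" "j < 3" "i \<noteq> j" for i j
    using that cases by (fastforce simp: less3 C_def e_def)
  have finC: "finite (C i)" for i using fin by (simp add: C_def)
  have pil: "pillar (h i) (C i)" if "i < 3" for i
    using W Wh hh that unfolding pillar_def equiangular_vectors_def by (auto simp: C_def)
  have le8: "card (C i) \<le> 8" if ij: "i < 3" "j < 3" "i \<noteq> j" and t: "t \<in> C j" for i j t
  proof (rule pillar_card_le_8[OF pil[OF ij(1)] finC pil[OF ij(2)] t])
    have no: "u \<notin> C j" if "u \<in> C i" for u using disj[OF ij] that by blast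
    have "t \<notin> C i" using disj[OF ij] t by blast
    have tW: "t \<in> W" using t by (simp add: C_def)
    show "h i \<bullet> h j = 0" using hh ij by simp
    show "t \<bullet> h i = 0" using Wh[OF tW ij(1)] \<open>t \<notin> C i\<close> by simp
    show "u \<bullet> h j = 0" if "u \<in> C i" for u
      using Wh[of u j] ij(2) that no by (simp add: C_def)
    show "\<bar>u \<bullet> t\<bar> = 1/3" if "u \<in> C i" for u
    proof -
      have "u \<in> W" "u \<noteq> t" using that \<open>t \<notin> C i\<close> by (auto simp: C_def)
      then show ?thesis using W tW by (simp add: equiangular_vectors_def)
    qed
  qed
  show ?thesis
  proof (cases "\<exists>i<3. C i = W")
    case True
    then obtain i where i: "i < 3" "C i = W" by blast
    define H where "H = h ` {..<3}"
    have inj: "inj_on h {..<3}"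
      by (rule inj_onI) (metis hh lessThan_iff zero_neq_one divide_eq_0_iff zero_neq_numeral)
    have "card (C i) + 2 * card H \<le> 2 * DIM('a)"
    proof (rule pillar_card_le_dim[OF pil[OF i(1)] finC])
      show "finite H" by (simp add: H_def)
      show "0 \<notin> H"
      proof
        assume "0 \<in> H"
        then obtain j where "j < 3" "h j = 0" by (auto simp: H_def)
        then show False using hh[of j j] by simp
      qed
      show "pairwise orthogonal H"
        using hh by (auto simp: H_def pairwise_def orthogonal_def)
      show "k = h i \<or> k \<bullet> h i = 0 \<and> (\<forall>u\<in>C i. u \<bullet> k = 0)" if "k \<in> H" for k
      proof -
        have "k \<in> h ` {..<3}" using that by (simp add: H_def)
        then obtain j where j: "j < 3" "k = h j" by blast
        show ?thesis
        proof (cases "j = i")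
          case False
          have "u \<bullet> h j = 0" if "u \<in> C i" for u
            using Wh[of u j] j disj[OF i(1) j(1)] False that by (auto simp: C_def)
          then show ?thesis using hh j i False by simp
        qed (use j in simp)
      qed
    qed
    then show ?thesis using i card_image[OF inj] by (simp add: H_def)
  next
    case False
    have small: "card (C i) \<le> 8" if i: "i < 3" for i
    proof -
      obtain t where "t \<in> W" "t \<notin> C i" using False i by (auto simp: C_def)
      then obtain j where "j < 3" "t \<in> C j" "j \<noteq> i" using union
        by (metis UnE less3)
      then show ?thesis using le8[of i j t] i by auto
    qed
    have "card W \<le> card (C 0 \<union> C 1) + card (C 2)" unfolding union by (rule card_Un_le)
    also have "\<dots> \<le> card (C 0) + card (C 1) + card (C 2)" by (simp add: card_Un_le)
    finally show ?thesis using small[of 0] small[of 1] small[of 2] by simp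
  qed
qed

text \<open>The three vectors \<open>x\<close>, \<open>y\<close>, \<open>z\<close> with sum \<open>q\<close> span a three-dimensional space that contains at most
  four of the vectors, and the remaining ones lie in the three pillars. The count of four
  is only an upper bound, as \<open>z\<close> may be a new vector.\<close>

lemma equiangular_vectors_third_card_le:
  fixes V :: "'a::euclidean_space set"
  assumes V: "equiangular_vectors (1/3) V" and fin: "finite V"
  shows "card V \<le> max 28 (2 * DIM('a) - 2)"
proof (cases "V = {}")
  case False
  then obtain q where q: "q \<in> V" by blast
  have third: "0 < (1/3 :: real)" "1/3 < (1 :: real)" by simp_all
  obtain W where W: "finite W" "equiangular_vectors (1/3) W" "card W = card V" "q \<in> W"
    and Wq: "\<And>u. u \<in> W \<Longrightarrow> u \<noteq> q \<Longrightarrow> u \<bullet> q = 1/3"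
    using equiangular_vectors_flip[OF V third q fin] by blast
  have unit: "u \<bullet> u = 1" if "u \<in> W" for u
    using W(2) that by (simp add: equiangular_vectors_def)
  show ?thesis
  proof (cases "\<exists>x\<in>W. \<exists>y\<in>W. x \<noteq> y \<and> x \<bullet> y \<noteq> 1/3")
    case False
    then have "card W \<le> DIM('a)"
      using W(1) unit by (intro equal_inner_card_le_dim[of W "1/3"]) auto
    then show ?thesis using W(3) by simp
  next
    case True
    then obtain x y where xy: "x \<in> W" "y \<in> W" "x \<noteq> y" "x \<bullet> y \<noteq> 1/3" by blast
    then have ip: "x \<bullet> y = -1/3"
      using equiangular_vectorsD[OF W(2) xy(1-3)] by simp
    have "x \<noteq> q" "y \<noteq> q"
      using xy Wq by (metis inner_commute)+
    then have xq: "x \<bullet> q = 1/3" "y \<bullet> q = 1/3" using Wq xy by auto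
    define z where "z = q - x - y"
    have ips: "y \<bullet> x = -1/3" "q \<bullet> x = 1/3" "q \<bullet> y = 1/3" "x \<bullet> x = 1" "y \<bullet> y = 1" "q \<bullet> q = 1"
      using ip xq unit xy W(4) by (auto simp: inner_commute)
    have z: "z \<bullet> z = 1" "x \<bullet> z = -1/3" "y \<bullet> z = -1/3"
      using ip xq ips by (auto simp: z_def inner_diff_left inner_diff_right)
    define W' where "W' = W - {q, x, y, z}"
    have "card W' \<le> 24 \<or> card W' + 6 \<le> 2 * DIM('a)"
    proof (rule card_le_three_pillars[of W' x y z])
      show "finite W'" using W(1) by (simp add: W'_def)
      show "equiangular_vectors (1/3) W'"
        using W(2) by (auto simp: equiangular_vectors_def W'_def)
      fix u assume u: "u \<in> W'"
      then have u': "u \<in> W" "u \<noteq> q" "u \<noteq> x" "u \<noteq> y" "u \<noteq> z" by (auto simp: W'_def)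
      \<comment> \<open>As \<open>u \<bullet> z\<close> is 1/3 minus two terms 1/3 or -1/3, the value 1 is the only one to exclude.\<close>
      have "u \<bullet> z \<noteq> 1" using unit_vectors_eqI[of u z] unit[OF u'(1)] z(1) u'(5) by blast
      moreover have "u \<bullet> z = u \<bullet> q - u \<bullet> x - u \<bullet> y" by (simp add: z_def inner_diff_right)
      moreover have "u \<bullet> q = 1/3" using Wq u' by blast
      ultimately show "u \<bullet> x = -1/3 \<and> u \<bullet> y = 1/3 \<and> u \<bullet> z = 1/3 \<or>
          u \<bullet> x = 1/3 \<and> u \<bullet> y = -1/3 \<and> u \<bullet> z = 1/3 \<or> u \<bullet> x = 1/3 \<and> u \<bullet> y = 1/3 \<and> u \<bullet> z = -1/3"
        using equiangular_vectorsD[OF W(2) u'(1) xy(1) u'(3)]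
          equiangular_vectorsD[OF W(2) u'(1) xy(2) u'(4)] by auto
    qed (use ip ips z in auto)
    moreover have "card W \<le> card W' + 4"
    proof -
      have "card W \<le> card (W' \<union> {q, x, y, z})"
        using W(1) by (intro card_mono) (auto simp: W'_def)
      also have "\<dots> \<le> card W' + card {q, x, y, z}" by (rule card_Un_le)
      also have "card {q, x, y, z} \<le> 4"
        using card_length[of "[q, x, y, z]"] by simp
      finally show ?thesis by simp
    qed
    ultimately show ?thesis using W(3) by auto
  qed
qed simp

section \<open>The two constructions\<close>

lemma exists_equiangular_double_frame:
  "\<exists>X :: (real ^ 'n::finite) set set. finite X \<and> equiangular (1/3) X \<and> card X = 2 * CARD('n) - 2"
proof -
  fix i\<^sub>0 :: 'n
  define I where "I = (UNIV - {i\<^sub>0}) \<times> {1, -1 :: real}"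
  define v :: "'n \<times> real \<Rightarrow> real ^ 'n" where
    "v = (\<lambda>(j, s). axis i\<^sub>0 1 + (s * sqrt 2) *\<^sub>R axis j 1)"
  have ip: "v p \<bullet> v p' = 1 + (if fst p = fst p' then 2 * snd p * snd p' else 0)"
    if "p \<in> I" "p' \<in> I" for p p'
    using that
    by (auto simp: I_def v_def inner_add_left inner_add_right inner_diff_left inner_diff_right inner_axis_axis)
  have "\<exists>X :: (real ^ 'n) set set. finite X \<and> equiangular (1/3) X \<and> card X = card I"
  proof (rule equiangular_spans[where r = 3 and v = v])
    show "v p \<bullet> v p = 3" if "p \<in> I" for p
      using ip[OF that that] that by (auto simp: I_def)
    show "\<bar>v p \<bullet> v p'\<bar> = 1/3 * 3" if "p \<in> I" "p' \<in> I" "p \<noteq> p'" for p p'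
      using ip[OF that(1,2)] that by (auto simp: I_def)
  qed (auto simp: I_def)
  moreover have "card I = 2 * CARD('n) - 2"
    by (simp add: I_def card_cartesian_product card_Diff_subset)
  ultimately show ?thesis by simp
qed

text \<open>The points are the residues modulo 7 and the lines are the translates of the difference set
  \<open>{0, 1, 3}\<close>.\<close>

definition fano_lines :: "nat set set" where
  "fano_lines = {{0,1,3}, {1,2,4}, {2,3,5}, {3,4,6}, {4,5,0}, {5,6,1}, {6,0,2}}"

lemma fano_lines_meet: "\<forall>L\<in>fano_lines. \<forall>M\<in>fano_lines. L \<noteq> M \<longrightarrow> card (L \<inter> M) = 1"
  by (simp add: fano_lines_def Int_insert_left)

lemma card_fano_line: "\<forall>L\<in>fano_lines. finite L \<and> card L = 3 \<and> L \<subseteq> {..<7}"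
  unfolding fano_lines_def by auto

lemma card_fano_lines: "card fano_lines = 7"
proof -
  have "fano_lines = set [{0,1,3}, {1,2,4}, {2,3,5}, {3,4,6}, {4,5,0}, {5,6,1}, {6,0,2}]"
    by (simp add: fano_lines_def)
  moreover have "distinct [{0,1,3::nat}, {1,2,4}, {2,3,5}, {3,4,6}, {4,5,0}, {5,6,1}, {6,0,2}]"
    by (simp add: set_eq_subset)
  ultimately have "card fano_lines = length [{0,1,3::nat}, {1,2,4}, {2,3,5}, {3,4,6}, {4,5,0}, {5,6,1}, {6,0,2}]"
    by (metis distinct_card)
  then show ?thesis by simp
qed

lemma exists_28_equiangular:
  assumes "CARD('n::finite) \<ge> 7"
  shows "\<exists>X :: (real ^ 'n) set set. finite X \<and> equiangular (1/3) X \<and> card X = 28"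
proof -
  obtain g :: "nat \<Rightarrow> 'n" where g: "inj_on g {..<7}"
    using assms card_le_inj[of "{..<7::nat}" "UNIV :: 'n set"] by auto
  define sg :: "nat set \<Rightarrow> nat \<Rightarrow> real" where "sg S i = (if i \<in> S then -1 else 1)" for S i
  define v :: "nat set \<times> nat set \<Rightarrow> real ^ 'n" where
    "v = (\<lambda>(L, S). \<Sum>i\<in>L. sg S i *\<^sub>R axis (g i) 1)"
  \<comment> \<open>A sign pattern on a Fano line is given by the set of its negative coordinates. Having at most
    one negative coordinate picks one pattern out of each opposite pair, because the line has three
    points; two such patterns differ in one or two places.\<close>
  define signs :: "nat set \<Rightarrow> nat set set" where "signs L = insert {} ((\<lambda>i. {i}) ` L)" for L
  define I where "I = Sigma fano_lines signs"
  have ip: "v (L, S) \<bullet> v (M, T) = (\<Sum>i\<in>L \<inter> M. sg S i * sg T i)"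
    if L: "L \<in> fano_lines" and M: "M \<in> fano_lines" for L M S T
  proof -
    have fin: "finite L" "finite M" and sub: "L \<subseteq> {..<7}" "M \<subseteq> {..<7}"
      using card_fano_line L M by auto
    have "v (L, S) \<bullet> v (M, T) = (\<Sum>i\<in>L. \<Sum>j\<in>M. sg S i * sg T j * (axis (g i) 1 \<bullet> (axis (g j) 1 :: real^'n)))"
      by (simp add: v_def inner_sum_left) (simp add: inner_sum_right sum_distrib_left mult.assoc)
    also have "\<dots> = (\<Sum>i\<in>L. \<Sum>j\<in>M. if i = j then sg S i * sg T i else 0)"
      using g sub by (intro sum.cong refl) (auto simp: inner_axis_axis inj_on_def)
    also have "\<dots> = (\<Sum>i\<in>L. if i \<in> M then sg S i * sg T i else 0)"
      using fin by simp
    also have "\<dots> = (\<Sum>i\<in>L \<inter> M. sg S i * sg T i)"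
      using fin by (simp add: sum.inter_restrict)
    finally show ?thesis .
  qed
  have "\<exists>X :: (real ^ 'n) set set. finite X \<and> equiangular (1/3) X \<and> card X = card I"
  proof (rule equiangular_spans[where r = 3 and v = v])
    have "finite fano_lines" by (simp add: fano_lines_def)
    then show "finite I" using card_fano_line by (auto simp: I_def signs_def)
    show "v p \<bullet> v p = 3" if "p \<in> I" for p
    proof -
      obtain L S where p: "p = (L, S)" "L \<in> fano_lines" using \<open>p \<in> I\<close> by (auto simp: I_def)
      have "(\<Sum>i\<in>L. sg S i * sg S i) = (\<Sum>i\<in>L. 1)" by (rule sum.cong) (auto simp: sg_def)
      then show ?thesis using ip p card_fano_line by simp
    qed
    show "\<bar>v p \<bullet> v p'\<bar> = 1/3 * 3" if "p \<in> I" "p' \<in> I" "p \<noteq> p'" for p p'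
    proof -
      obtain L S M T where p: "p = (L, S)" "p' = (M, T)" "L \<in> fano_lines" "M \<in> fano_lines"
        "S \<in> signs L" "T \<in> signs M"
        using \<open>p \<in> I\<close> \<open>p' \<in> I\<close> by (auto simp: I_def)
      show ?thesis
      proof (cases "L = M")
        case False
        then obtain i where "L \<inter> M = {i}"
          using fano_lines_meet p by (metis card_1_singletonE)
        then show ?thesis using ip p by (auto simp: sg_def)
      next
        case True
        then have ST: "S \<noteq> T" using p \<open>p \<noteq> p'\<close> by simp
        obtain a b c where L: "L = {a, b, c}" "a \<noteq> b" "a \<noteq> c" "b \<noteq> c"
          using card_fano_line p(3) by (metis card_3_iff)
        have "v p \<bullet> v p' = (\<Sum>i\<in>L. sg S i * sg T i)"
          using ip[OF p(3,4), of S T] p(1,2) True by simp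
        also have "\<dots> = sg S a * sg T a + sg S b * sg T b + sg S c * sg T c"
          unfolding L(1) using L(2-4) by simp
        finally have "v p \<bullet> v p' = sg S a * sg T a + sg S b * sg T b + sg S c * sg T c" .
        moreover have "S \<in> {{}, {a}, {b}, {c}}" "T \<in> {{}, {a}, {b}, {c}}"
          using p True L by (auto simp: signs_def)
        ultimately show ?thesis using ST L by (auto simp: sg_def)
      qed
    qed
  qed auto
  moreover have "card I = 28"
  proof -
    have "card (signs L) = 4" if "L \<in> fano_lines" for L
    proof -
      have L: "finite L" "card L = 3" using card_fano_line that by auto
      have "card ((\<lambda>i. {i}) ` L) = 3" using L by (simp add: card_image)
      then show ?thesis using L by (simp add: signs_def card_insert_if image_iff)
    qed
    moreover have "finite fano_lines" by (simp add: fano_lines_def)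
    ultimately show ?thesis
      using card_fano_lines card_fano_line by (simp add: I_def signs_def)
  qed
  ultimately show ?thesis by simp
qed

section \<open>The maximum\<close>

lemma N_eqI:
  assumes \<alpha>: "\<alpha> < 1"
    and ex: "\<exists>X :: 'a::euclidean_space set set. finite X \<and> equiangular \<alpha> X \<and> card X = m"
    and le: "\<And>X :: 'a set set. finite X \<Longrightarrow> equiangular \<alpha> X \<Longrightarrow> card X \<le> m"
  shows "N \<alpha> TYPE('a) = m"
  unfolding N_def
proof (rule Max_eqI)
  show "finite {card X |X :: 'a set set. finite X \<and> equiangular \<alpha> X}"
    by (rule finite_subset[of _ "{..m}"]) (use le in auto)
qed (use ex le in auto)

lemma equiangular_third_card_le:
  fixes X :: "'a::euclidean_space set set"
  assumes "equiangular (1/3) X" "finite X"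
  shows "card X \<le> max 28 (2 * DIM('a) - 2)"
proof -
  obtain V :: "'a set" where "finite V" "equiangular_vectors (1/3) V" "card V = card X"
    by (rule equiangular_vectors_of_lines[OF assms]) simp_all
  then show ?thesis using equiangular_vectors_third_card_le[of V] by simp
qed

theorem theorem1:
  "(7 \<le> CARD('n::finite) \<and> CARD('n) \<le> 15 \<longrightarrow> N (1 / 3) TYPE(real ^ 'n) = 28) \<and>
   (15 \<le> CARD('n) \<longrightarrow> N (1 / 3) TYPE(real ^ 'n) = 2 * CARD('n) - 2)"
proof (intro conjI impI)
  assume n: "7 \<le> CARD('n) \<and> CARD('n) \<le> 15"
  show "N (1/3) TYPE(real ^ 'n) = 28"
  proof (rule N_eqI)
    show "\<exists>X :: (real ^ 'n) set set. finite X \<and> equiangular (1/3) X \<and> card X = 28"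
      using n by (intro exists_28_equiangular) simp
    show "card X \<le> 28" if "finite X" "equiangular (1/3) X" for X :: "(real ^ 'n) set set"
      using equiangular_third_card_le[OF that(2,1)] n by (simp add: max_def split: if_splits)
  qed simp
next
  assume n: "15 \<le> CARD('n)"
  show "N (1/3) TYPE(real ^ 'n) = 2 * CARD('n) - 2"
  proof (rule N_eqI)
    show "\<exists>X :: (real ^ 'n) set set. finite X \<and> equiangular (1/3) X \<and> card X = 2 * CARD('n) - 2"
      by (rule exists_equiangular_double_frame)
    show "card X \<le> 2 * CARD('n) - 2" if "finite X" "equiangular (1/3) X" for X :: "(real ^ 'n) set set"
      using equiangular_third_card_le[OF that(2,1)] n by simp
  qed simp
qed

end
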